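(* Let $Q_0$ be a cube in $\mathbb{R}^n$ and $f\in L^1(Q_0)$. Then the following statements are equivalent: (i) $f\in\bar{\mathcal{L}}^{1,n}(Q_0)$; (ii) $f\in BMO(Q_0)$ and $f^-\in L^\infty(Q_0)$; (iii) there is a constant $C$ such that for every cube $Q\subset Q_0$, $$\frac{1}{|Q|}\int_Q\big||f(x)|-f_Q\big|\,dx\le C.$$
   Context: Cubes have sides parallel to the coordinate axes; $Q(x,\rho)$ is the cube with center $x$ and side length $2\rho$, and $Q_0(x_0,\rho):=Q(x_0,\rho)\cap Q_0$. For a set $E$ of positive finite measure, $f_E:=\frac{1}{|E|}\int_Ef(y)\,dy$ and $|f|_E:=\frac{1}{|E|}\int_E|f(y)|\,dy$. Also $f^-:=-\min\{f,0\}$. The space $BMO(Q_0)$ consists of $f\in L^1(Q_0)$ with $\sup_{Q\subset Q_0}\frac{1}{|Q|}\int_Q|f-f_Q|\,dx<\infty$, the supremum being over all cubes $Q\subset Q_0$. The class $\bar{\mathcal{L}}^{1,n}(Q_0)$ consists of the functions $f\in L^1(Q_0)$ with $$\sup_{x_0\in Q_0,\rho>0}\rho^{-n}\int_{Q_0(x_0,\rho)}\big|f(x)-|f|_{Q_0(x_0,\rho)}\big|\,dx<\infty.$$ *)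

theory Defs
  imports "HOL-Analysis.Analysis"
begin

text \<open>Cubes are taken closed; boundaries are null sets, so all averages below are
  insensitive to this choice.  Functions on \<open>Q0\<close> are total functions of which only the values
  on \<open>Q0\<close> matter.\<close>

definition cube :: "real ^ 'n \<Rightarrow> real \<Rightarrow> (real ^ 'n) set" where
  "cube x \<rho> = cbox (\<chi> i. x $ i - \<rho>) (\<chi> i. x $ i + \<rho>)"

definition is_cube :: "(real ^ 'n) set \<Rightarrow> bool" where
  "is_cube Q \<longleftrightarrow> (\<exists>x \<rho>. 0 < \<rho> \<and> Q = cube x \<rho>)"

definition cube_in :: "(real ^ 'n) set \<Rightarrow> real ^ 'n \<Rightarrow> real \<Rightarrow> (real ^ 'n) set" where
  "cube_in Q0 x0 \<rho> = cube x0 \<rho> \<inter> Q0"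

text \<open>The average \<open>f\<^sub>E\<close>; thus \<open>|f|\<^sub>E\<close> is \<open>avg E (\<lambda>x. \<bar>f x\<bar>)\<close>.\<close>

definition avg :: "(real ^ 'n) set \<Rightarrow> (real ^ 'n \<Rightarrow> real) \<Rightarrow> real" where
  "avg E f = (1 / measure lebesgue E) * (LINT y:E|lebesgue. f y)"

definition neg_part :: "('a \<Rightarrow> real) \<Rightarrow> 'a \<Rightarrow> real" where
  "neg_part f = (\<lambda>x. - min (f x) 0)"

definition L1 :: "(real ^ 'n) set \<Rightarrow> (real ^ 'n \<Rightarrow> real) set" where
  "L1 E = {f. set_integrable lebesgue E f}"

definition Linfty :: "(real ^ 'n) set \<Rightarrow> (real ^ 'n \<Rightarrow> real) set" where
  "Linfty E = {f. f \<in> borel_measurable (lebesgue_on E) \<and>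
                  (\<exists>C. AE x in lebesgue_on E. \<bar>f x\<bar> \<le> C)}"

text \<open>A supremum of real numbers being finite is expressed by \<^const>\<open>bdd_above\<close>, since
  \<^const>\<open>Sup\<close> on the reals is unspecified for unbounded sets.\<close>

definition BMO :: "(real ^ 'n) set \<Rightarrow> (real ^ 'n \<Rightarrow> real) set" where
  "BMO Q0 = {f \<in> L1 Q0. bdd_above {avg Q (\<lambda>x. \<bar>f x - avg Q f\<bar>) | Q. is_cube Q \<and> Q \<subseteq> Q0}}"

definition Lbar1n :: "(real ^ 'n) set \<Rightarrow> (real ^ 'n \<Rightarrow> real) set" where
  "Lbar1n Q0 = {f \<in> L1 Q0.
     bdd_above {(1 / \<rho> ^ CARD('n)) *
         (LINT x:cube_in Q0 x0 \<rho>|lebesgue. \<bar>f x - avg (cube_in Q0 x0 \<rho>) (\<lambda>y. \<bar>f y\<bar>)\<bar>)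
       | x0 \<rho>. x0 \<in> Q0 \<and> 0 < \<rho>}}"

end

theory Submission
  imports Defs
begin

text \<open>
  Everything rests on the pointwise identity \<open>|f| = f + 2 f\<^sup>-\<close>, whose average over \<open>E\<close> reads
  \<open>|f|\<^sub>E - f\<^sub>E = 2 (f\<^sup>-)\<^sub>E\<close>.  Each of (i) and (iii) compares one of \<open>f\<close>, \<open>|f|\<close> with the average of
  the other.  Since \<open>\<bar>g\<^sub>E - c\<bar>\<close> is at most the mean deviation of \<open>g\<close> from \<open>c\<close>, either
  condition bounds \<open>|f|\<^sub>Q - f\<^sub>Q\<close>, that is, bounds the averages of \<open>f\<^sup>-\<close> over all cubes
  \<open>Q \<subseteq> Q\<^sub>0\<close>.  By Lebesgue differentiation (\<open>AE_interior_le_if_avg_cubes_le\<close>) \<open>f\<^sup>-\<close> itself is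
  bounded almost everywhere.  Once the averages of \<open>f\<^sup>-\<close> are under control, replacing \<open>f\<close> by
  \<open>|f|\<close>, or \<open>f\<^sub>Q\<close> by \<open>|f|\<^sub>Q\<close>, changes a mean deviation by a bounded amount only
  (\<open>avg_dev_le\<close>), so all the conditions agree on cubes inside \<open>Q\<^sub>0\<close>.

  The sets \<open>Q\<^sub>0(x\<^sub>0,\<rho>)\<close> in (i) may be boxes cut off by the boundary of \<open>Q\<^sub>0\<close>.  Such a box lies in a
  cube \<open>Q \<subseteq> Q\<^sub>0\<close> of radius at most \<open>\<rho>\<close> (\<open>cube_in_subset_cube\<close>).  Because (i) normalises
  by \<open>\<rho>\<^sup>n\<close> and not by the measure of the box, the oscillation over \<open>Q\<close> controls the one over
  the box directly.
\<close>

section \<open>Averages and mean deviations\<close>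

lemma measure_mult_avg:
  assumes "measure lebesgue E > 0"
  shows "measure lebesgue E * avg E g = (LINT x:E|lebesgue. g x)"
  using assms by (simp add: avg_def)

lemma avg_add:
  assumes "set_integrable lebesgue E f" "set_integrable lebesgue E g"
  shows "avg E (\<lambda>x. f x + g x) = avg E f + avg E g"
  using assms by (simp add: avg_def set_integral_add(2) algebra_simps add_divide_distrib)

lemma avg_diff:
  assumes "set_integrable lebesgue E f" "set_integrable lebesgue E g"
  shows "avg E (\<lambda>x. f x - g x) = avg E f - avg E g"
  using assms by (simp add: avg_def set_integral_diff(2) diff_divide_distrib)

lemma avg_cmult: "avg E (\<lambda>x. c * f x) = c * avg E f"
  by (simp add: avg_def)

lemma set_integrable_const:
  assumes "E \<in> lmeasurable"
  shows "set_integrable lebesgue E (\<lambda>x. c::real)"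
  using assms unfolding set_integrable_def
  by (intro integrable_scaleR_left) (auto simp: fmeasurable_def)

lemma avg_const:
  assumes "E \<in> lmeasurable" "measure lebesgue E > 0"
  shows "avg E (\<lambda>x. c) = c"
proof -
  have "(LINT x:E|lebesgue. c) = measure lebesgue E *\<^sub>R c"
    by (rule set_integral_const) (use assms in \<open>auto simp: fmeasurable_def\<close>)
  thus ?thesis using assms by (simp add: avg_def)
qed

lemma avg_mono:
  assumes "set_integrable lebesgue E f" "set_integrable lebesgue E g"
    and "AE x\<in>E in lebesgue. f x \<le> g x"
  shows "avg E f \<le> avg E g"
  unfolding avg_def
  by (intro mult_left_mono set_integral_mono_AE assms) auto

lemma avg_le_const:
  assumes "E \<in> lmeasurable" "measure lebesgue E > 0" "set_integrable lebesgue E f"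
    and "AE x\<in>E in lebesgue. f x \<le> c"
  shows "avg E f \<le> c"
  using avg_mono[OF assms(3) set_integrable_const[OF assms(1)] assms(4)] avg_const[OF assms(1,2)]
  by simp

lemma set_integrable_dev:
  assumes "E \<in> lmeasurable" "set_integrable lebesgue E f"
  shows "set_integrable lebesgue E (\<lambda>x. \<bar>f x - c :: real\<bar>)"
  using assms by (intro set_integrable_abs set_integral_diff(1) set_integrable_const)

text \<open>Changing the function costs the mean distance between the two functions, changing the
  constant costs its displacement.  All comparisons of oscillations below are instances.\<close>

lemma avg_dev_le:
  assumes E: "E \<in> lmeasurable" "measure lebesgue E > 0"
    and f: "set_integrable lebesgue E f" and g: "set_integrable lebesgue E g"
  shows "avg E (\<lambda>x. \<bar>f x - c\<bar>)
           \<le> avg E (\<lambda>x. \<bar>g x - d\<bar>) + avg E (\<lambda>x. \<bar>f x - g x\<bar>) + \<bar>c - d\<bar>"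
proof -
  note int = set_integrable_dev[OF E(1) f] set_integrable_dev[OF E(1) g]
    set_integrable_abs[OF set_integral_diff(1)[OF f g]] set_integrable_const[OF E(1)]
  have "avg E (\<lambda>x. \<bar>f x - c\<bar>) \<le> avg E (\<lambda>x. \<bar>g x - d\<bar> + \<bar>f x - g x\<bar> + \<bar>c - d\<bar>)"
    by (rule avg_mono) (auto intro!: set_integral_add(1) int)
  also have "\<dots> = avg E (\<lambda>x. \<bar>g x - d\<bar>) + avg E (\<lambda>x. \<bar>f x - g x\<bar>) + \<bar>c - d\<bar>"
    by (simp add: avg_add set_integral_add(1) int avg_const[OF E])
  finally show ?thesis .
qed

lemma abs_avg_diff_const_le:
  assumes E: "E \<in> lmeasurable" "measure lebesgue E > 0"
    and g: "set_integrable lebesgue E g"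
  shows "\<bar>avg E g - c\<bar> \<le> avg E (\<lambda>x. \<bar>g x - c\<bar>)"
proof -
  note c = set_integrable_const[OF E(1), of c]
  note d = set_integrable_dev[OF E(1) g, of c]
  have "avg E (\<lambda>x. g x - c) \<le> avg E (\<lambda>x. \<bar>g x - c\<bar>)"
    by (rule avg_mono) (auto intro!: set_integral_diff(1) g c d)
  moreover have "avg E (\<lambda>x. c - g x) \<le> avg E (\<lambda>x. \<bar>g x - c\<bar>)"
    by (rule avg_mono) (auto intro!: set_integral_diff(1) g c d)
  ultimately show ?thesis
    by (simp add: avg_diff g c avg_const[OF E])
qed

section \<open>The negative part\<close>

lemma neg_part_nonneg: "0 \<le> neg_part f x"
  by (simp add: neg_part_def)

lemma neg_part_eq: "neg_part f = (\<lambda>x. (1/2) * (\<bar>f x\<bar> - f x))"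
  by (auto simp: neg_part_def min_def)

lemma set_integrable_neg_part:
  assumes "set_integrable lebesgue E f"
  shows "set_integrable lebesgue E (neg_part f)"
  unfolding neg_part_eq
  by (intro set_integrable_mult_right set_integral_diff(1) set_integrable_abs assms)

lemma avg_abs_diff_avg:
  assumes "set_integrable lebesgue E f"
  shows "avg E (\<lambda>x. \<bar>f x\<bar>) - avg E f = 2 * avg E (neg_part f)"
  using avg_diff[OF set_integrable_abs[OF assms] assms]
  unfolding neg_part_eq avg_cmult by linarith

lemma avg_dist_abs_self: "avg E (\<lambda>x. \<bar>\<bar>f x\<bar> - f x\<bar>) = 2 * avg E (neg_part f)"
proof -
  have "\<bar>\<bar>f x\<bar> - f x\<bar> = 2 * neg_part f x" for x
    by (simp add: neg_part_def)
  thus ?thesis by (simp only: avg_cmult)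
qed

text \<open>The mean deviation of \<open>f\<close> from the average of \<open>|f|\<close>, and that of \<open>|f|\<close> from the
  average of \<open>f\<close>, each dominate \<open>|f|\<^sub>E - f\<^sub>E\<close>; this is how (i) and (iii) control \<open>f\<^sup>-\<close>.\<close>

lemma avg_neg_part_le:
  assumes "E \<in> lmeasurable" "measure lebesgue E > 0" "set_integrable lebesgue E f"
  shows "2 * avg E (neg_part f) \<le> avg E (\<lambda>x. \<bar>f x - avg E (\<lambda>y. \<bar>f y\<bar>)\<bar>)"
    and "2 * avg E (neg_part f) \<le> avg E (\<lambda>x. \<bar>\<bar>f x\<bar> - avg E f\<bar>)"
  using abs_avg_diff_const_le[OF assms, of "avg E (\<lambda>y. \<bar>f y\<bar>)"]
    abs_avg_diff_const_le[OF assms(1,2) set_integrable_abs[OF assms(3)], of "avg E f"]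
    avg_abs_diff_avg[OF assms(3)]
  by linarith+

section \<open>Cubes\<close>

lemma mem_cube: "y \<in> cube x r \<longleftrightarrow> (\<forall>i. x $ i - r \<le> y $ i \<and> y $ i \<le> x $ i + r)"
  by (simp add: cube_def mem_box_cart)

lemma lmeasurable_cube [simp]: "cube x r \<in> lmeasurable"
  by (simp add: cube_def)

lemma measure_cube:
  fixes x :: "real ^ 'n"
  assumes "0 \<le> r"
  shows "measure lebesgue (cube x r) = (2 * r) ^ CARD('n)"
proof -
  have "cube x r \<noteq> {}" using assms by (auto simp: mem_cube intro!: exI[of _ x] simp flip: ex_in_conv)
  thus ?thesis unfolding cube_def by (simp add: content_cbox_cart measure_completion)
qed

lemma is_cube_lmeasurable:
  assumes "is_cube Q"
  shows "Q \<in> lmeasurable" "measure lebesgue Q > 0"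
  using assms by (auto simp: is_cube_def measure_cube)

lemma cube_in_subset_cube:
  fixes Q0 :: "(real ^ 'n) set"
  assumes "is_cube Q0" "0 < \<rho>"
  obtains x r where "0 < r" "r \<le> \<rho>" "cube_in Q0 x0 \<rho> \<subseteq> cube x r" "cube x r \<subseteq> Q0"
proof -
  obtain c R where R: "0 < R" and Q0: "Q0 = cube c R" using assms by (auto simp: is_cube_def)
  define r where "r = min \<rho> R"
  \<comment> \<open>The centre is moved, coordinate by coordinate, to the nearest position at which a cube of
    radius \<open>r\<close> fits into \<open>Q0\<close>.\<close>
  define x :: "real ^ 'n" where "x = (\<chi> i. max (c $ i - R + r) (min (x0 $ i) (c $ i + R - r)))"
  have "y \<in> cube x r" if "y \<in> cube x0 \<rho>" "y \<in> cube c R" for y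
    unfolding mem_cube
  proof
    fix i
    have "x0 $ i - \<rho> \<le> y $ i" "y $ i \<le> x0 $ i + \<rho>" "c $ i - R \<le> y $ i" "y $ i \<le> c $ i + R"
      using that by (auto simp: mem_cube)
    thus "x $ i - r \<le> y $ i \<and> y $ i \<le> x $ i + r"
      by (auto simp: x_def r_def max_def min_def)
  qed
  moreover have "cube x r \<subseteq> cube c R"
  proof
    fix y assume y: "y \<in> cube x r"
    show "y \<in> cube c R" unfolding mem_cube
    proof
      fix i
      have "x $ i - r \<le> y $ i" "y $ i \<le> x $ i + r" using y by (auto simp: mem_cube)
      moreover have "c $ i - R + r \<le> x $ i" "x $ i \<le> c $ i + R - r"
        by (auto simp: x_def r_def)
      ultimately show "c $ i - R \<le> y $ i \<and> y $ i \<le> c $ i + R" by linarith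
    qed
  qed
  ultimately show ?thesis
    using that[of r x] assms(2) R by (auto simp: cube_in_def Q0 r_def)
qed

section \<open>Lebesgue differentiation along cubes\<close>

text \<open>At almost every point \<open>x\<close>, a locally integrable function is the limit of its averages over
  the cubes having \<open>x\<close> as a corner; inside the interior of \<open>S\<close> these cubes eventually lie in
  \<open>S\<close>.\<close>

lemma AE_interior_le_if_avg_cubes_le:
  fixes g :: "real ^ 'n \<Rightarrow> real"
  assumes g: "set_integrable lebesgue S g"
    and avg: "\<And>Q. is_cube Q \<Longrightarrow> Q \<subseteq> S \<Longrightarrow> avg Q g \<le> K"
  shows "AE x in lebesgue. x \<in> interior S \<longrightarrow> g x \<le> K"
proof -
  define G where "G = (\<lambda>x. indicator S x *\<^sub>R g x)"
  have G: "set_integrable lebesgue UNIV G"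
    using g by (simp add: set_integrable_def G_def)
  have "G integrable_on cbox a b" for a b
    by (rule set_lebesgue_integral_eq_integral(1), rule set_integrable_subset[OF G]) auto
  then obtain N where N: "negligible N"
    and lim: "\<And>x e. \<lbrakk>x \<notin> N; 0 < e\<rbrakk> \<Longrightarrow> \<exists>d>0. \<forall>h. 0 < h \<and> h < d \<longrightarrow>
        norm (integral (cbox x (x + h *\<^sub>R One)) G /\<^sub>R h ^ DIM(real ^ 'n) - G x) < e"
    using integrable_ccontinuous_explicit[of G] by metis
  have "g x \<le> K" if x: "x \<notin> N" "x \<in> interior S" for x
  proof (rule ccontr)
    assume "\<not> g x \<le> K"
    have Gx: "G x = g x" using x(2) interior_subset[of S] by (auto simp: G_def indicator_def)
    obtain d where "d > 0" and d: "\<And>h. 0 < h \<Longrightarrow> h < d \<Longrightarrow>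
        norm (integral (cbox x (x + h *\<^sub>R One)) G /\<^sub>R h ^ DIM(real ^ 'n) - G x) < g x - K"
      using lim[OF x(1), of "g x - K"] \<open>\<not> g x \<le> K\<close> by auto
    obtain r where "r > 0" and r: "ball x r \<subseteq> S" using x(2) by (auto simp: mem_interior)
    \<comment> \<open>A cube of side \<open>h\<close> with corner \<open>x\<close> has points at \<open>l\<^sup>1\<close>-distance up to \<open>n h\<close> from \<open>x\<close>.\<close>
    define h where "h = min (d / 2) (r / (2 * CARD('n)))"
    have h: "0 < h" "h < d" "h * CARD('n) < r"
    proof -
      show "0 < h" "h < d" using \<open>d > 0\<close> \<open>r > 0\<close> by (auto simp: h_def)
      have "h * CARD('n) \<le> r / (2 * CARD('n)) * CARD('n)"
        by (rule mult_right_mono) (auto simp: h_def)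
      also have "\<dots> < r" using \<open>r > 0\<close> by simp
      finally show "h * CARD('n) < r" .
    qed
    define Q where "Q = cube (\<chi> i. x $ i + h / 2) (h / 2)"
    have One: "(\<Sum>b\<in>Basis. (b :: real ^ 'n) $ i) = 1" for i
      using cart_eq_inner_axis[of "One :: real ^ 'n" i] by simp
    have Q: "cbox x (x + h *\<^sub>R One) = Q"
    proof -
      have "x $ i + h / 2 + h / 2 = x $ i + h" for i by simp
      thus ?thesis by (simp add: set_eq_iff Q_def mem_cube mem_box_cart One add.commute)
    qed
    have "is_cube Q" using h(1) half_gt_zero unfolding is_cube_def Q_def by blast
    have "Q \<subseteq> S"
    proof
      fix y assume "y \<in> Q"
      hence "x $ i \<le> y $ i \<and> y $ i \<le> x $ i + h" for i
        by (simp flip: Q add: mem_box_cart One)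
      hence "\<bar>(y - x) $ i\<bar> \<le> h" for i
        using \<open>0 < h\<close> by (smt (verit) vector_minus_component)
      hence "norm (y - x) \<le> (\<Sum>i\<in>(UNIV :: 'n set). h)"
        by (intro order_trans[OF norm_le_l1_cart] sum_mono) auto
      also have "\<dots> < r" using h by (simp add: mult.commute)
      finally show "y \<in> S" using r by (auto simp: dist_norm norm_minus_commute)
    qed
    have "measure lebesgue Q = h ^ CARD('n)" using h by (simp add: Q_def measure_cube)
    moreover have "integral Q G = (LINT x:Q|lebesgue. g x)"
    proof -
      have "set_integrable lebesgue Q G"
        by (rule set_integrable_subset[OF G]) (auto simp: Q_def cube_def)
      hence "integral Q G = (LINT x:Q|lebesgue. G x)"
        by (simp add: set_lebesgue_integral_eq_integral)
      also have "\<dots> = (LINT x:Q|lebesgue. g x)"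
        by (rule set_lebesgue_integral_cong) (use \<open>Q \<subseteq> S\<close> in \<open>auto simp: G_def Q_def cube_def\<close>)
      finally show ?thesis .
    qed
    ultimately have "integral Q G /\<^sub>R h ^ DIM(real ^ 'n) = avg Q g"
      by (simp add: avg_def divide_inverse)
    hence "\<bar>avg Q g - g x\<bar> < g x - K" using d[OF h(1,2)] by (simp add: Q Gx)
    thus False using avg[OF \<open>is_cube Q\<close> \<open>Q \<subseteq> S\<close>] by linarith
  qed
  hence "{x. \<not> (x \<in> interior S \<longrightarrow> g x \<le> K)} \<subseteq> N" by auto
  thus ?thesis using N
    by (intro AE_I'[of N]) (auto simp: negligible_iff_null_sets)
qed

lemma neg_part_Linfty_if_avg_cubes_le:
  assumes Q0: "is_cube Q0" and f: "f \<in> L1 Q0"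
    and avg: "\<And>Q. is_cube Q \<Longrightarrow> Q \<subseteq> Q0 \<Longrightarrow> avg Q (neg_part f) \<le> K"
  shows "neg_part f \<in> Linfty Q0"
proof -
  have int: "set_integrable lebesgue Q0 (neg_part f)"
    using f by (simp add: L1_def set_integrable_neg_part)
  have meas: "Q0 \<in> sets lebesgue" using is_cube_lmeasurable[OF Q0] by (auto simp: fmeasurable_def)
  have "negligible (frontier Q0)"
    using Q0 by (auto simp: is_cube_def cube_def intro!: negligible_convex_frontier convex_box)
  hence "AE x in lebesgue. x \<notin> frontier Q0"
    by (intro AE_not_in) (simp add: negligible_iff_null_sets)
  moreover have "AE x in lebesgue. x \<in> interior Q0 \<longrightarrow> neg_part f x \<le> K"
    by (rule AE_interior_le_if_avg_cubes_le[OF int avg])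
  ultimately have "AE x in lebesgue. x \<in> Q0 \<longrightarrow> \<bar>neg_part f x\<bar> \<le> K"
    by eventually_elim
      (use neg_part_nonneg[of f] closure_subset[of Q0] in \<open>auto simp: frontier_def\<close>)
  moreover have "neg_part f \<in> borel_measurable (lebesgue_on Q0)"
    using int meas by (simp add: set_integrable_eq borel_measurable_integrable)
  ultimately show ?thesis
    using meas by (auto simp: Linfty_def AE_restrict_space_iff)
qed

section \<open>The equivalence\<close>

lemma BMO_iff:
  "f \<in> BMO Q0 \<longleftrightarrow> f \<in> L1 Q0 \<and>
     (\<exists>B. \<forall>Q. is_cube Q \<and> Q \<subseteq> Q0 \<longrightarrow> avg Q (\<lambda>x. \<bar>f x - avg Q f\<bar>) \<le> B)"
  by (auto simp: BMO_def bdd_above_def)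

lemma Lbar1n_iff:
  fixes f :: "real ^ 'n \<Rightarrow> real"
  shows "f \<in> Lbar1n Q0 \<longleftrightarrow> f \<in> L1 Q0 \<and>
     (\<exists>B. \<forall>x0 \<rho>. x0 \<in> Q0 \<and> 0 < \<rho> \<longrightarrow> (1 / \<rho> ^ CARD('n)) *
        (LINT x:cube_in Q0 x0 \<rho>|lebesgue. \<bar>f x - avg (cube_in Q0 x0 \<rho>) (\<lambda>y. \<bar>f y\<bar>)\<bar>) \<le> B)"
  by (auto simp: Lbar1n_def bdd_above_def)

lemma L1_subset:
  assumes "f \<in> L1 Q0" "E \<subseteq> Q0" "E \<in> lmeasurable"
  shows "set_integrable lebesgue E f"
  using assms unfolding L1_def by (auto intro: set_integrable_subset simp: fmeasurable_def)

text \<open>The essential bound is made nonnegative so that \<open>M\<close> times the measure grows with the set.\<close>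

lemma AE_neg_part_le:
  assumes "Q0 \<in> sets lebesgue" "neg_part f \<in> Linfty Q0"
  obtains M where "0 \<le> M" "AE x\<in>Q0 in lebesgue. neg_part f x \<le> M"
proof -
  obtain M where "AE x\<in>Q0 in lebesgue. \<bar>neg_part f x\<bar> \<le> M"
    using assms by (auto simp: Linfty_def AE_restrict_space_iff)
  hence "AE x\<in>Q0 in lebesgue. neg_part f x \<le> max M 0"
    by eventually_elim auto
  thus ?thesis using that[of "max M 0"] by simp
qed

text \<open>The point is that \<open>c\<close> need not come from \<open>E\<close>: for a cut-off box \<open>E\<close> it will be the average
  of \<open>f\<close> over a surrounding cube.  Passing from \<open>c\<close> to \<open>f\<^sub>E\<close> costs one more deviation from
  \<open>c\<close>, and passing from \<open>f\<^sub>E\<close> to \<open>|f|\<^sub>E\<close> costs \<open>2 (f\<^sup>-)\<^sub>E \<le> 2 M\<close>.\<close>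

lemma integral_dev_avg_abs_le:
  assumes E: "E \<in> lmeasurable" and f: "set_integrable lebesgue E f"
    and M: "AE x\<in>E in lebesgue. neg_part f x \<le> M"
  shows "(LINT x:E|lebesgue. \<bar>f x - avg E (\<lambda>y. \<bar>f y\<bar>)\<bar>)
           \<le> 2 * (LINT x:E|lebesgue. \<bar>f x - c\<bar>) + 2 * M * measure lebesgue E"
proof (cases "measure lebesgue E > 0")
  case True
  note E = E True
  have "avg E (\<lambda>x. \<bar>f x - avg E (\<lambda>y. \<bar>f y\<bar>)\<bar>)
      \<le> avg E (\<lambda>x. \<bar>f x - c\<bar>) + avg E (\<lambda>x. \<bar>f x - f x\<bar>) + \<bar>avg E (\<lambda>y. \<bar>f y\<bar>) - c\<bar>"
    by (rule avg_dev_le[OF E f f])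
  moreover have "avg E (\<lambda>x. \<bar>f x - f x\<bar>) = 0" by (simp add: avg_def)
  moreover have "\<bar>avg E f - c\<bar> \<le> avg E (\<lambda>x. \<bar>f x - c\<bar>)"
    by (rule abs_avg_diff_const_le[OF E f])
  moreover have "avg E (\<lambda>x. \<bar>f x\<bar>) - avg E f = 2 * avg E (neg_part f)"
    by (rule avg_abs_diff_avg[OF f])
  moreover have "avg E (neg_part f) \<le> M"
    by (rule avg_le_const[OF E set_integrable_neg_part[OF f] M])
  moreover have "0 \<le> avg E (neg_part f)"
    by (auto simp: avg_def set_lebesgue_integral_def neg_part_nonneg
        intro!: divide_nonneg_nonneg Bochner_Integration.integral_nonneg)
  ultimately have "avg E (\<lambda>x. \<bar>f x - avg E (\<lambda>y. \<bar>f y\<bar>)\<bar>) \<le> 2 * avg E (\<lambda>x. \<bar>f x - c\<bar>) + 2 * M"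
    by linarith
  from mult_left_mono[OF this, of "measure lebesgue E"] show ?thesis
    by (simp add: measure_mult_avg[OF E(2)] distrib_left algebra_simps)
next
  \<comment> \<open>On a null set \<open>avg\<close> takes the value 0, but the integrals vanish whatever it is.\<close>
  case False
  hence m0: "measure lebesgue E = 0" by (simp add: zero_less_measure_iff)
  hence "E \<in> null_sets lebesgue"
    using E by (simp flip: negligible_iff_null_sets add: negligible_iff_measure)
  hence "AE x in lebesgue. x \<notin> E" by (rule AE_not_in)
  hence "AE x in lebesgue. indicator E x *\<^sub>R \<bar>f x - avg E (\<lambda>y. \<bar>f y\<bar>)\<bar> = 0"
    by eventually_elim auto
  hence "(LINT x:E|lebesgue. \<bar>f x - avg E (\<lambda>y. \<bar>f y\<bar>)\<bar>) = 0"
    unfolding set_lebesgue_integral_def by (rule integral_eq_zero_AE)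
  moreover have "0 \<le> (LINT x:E|lebesgue. \<bar>f x - c\<bar>)"
    by (auto simp: set_lebesgue_integral_def)
  ultimately show ?thesis by (simp add: m0)
qed

lemma BMO_and_neg_part_Linfty_if_Lbar1n:
  fixes Q0 :: "(real ^ 'n) set"
  assumes Q0: "is_cube Q0" and L: "f \<in> Lbar1n Q0"
  shows "f \<in> BMO Q0 \<and> neg_part f \<in> Linfty Q0"
proof -
  have f: "f \<in> L1 Q0" using L by (simp add: Lbar1n_iff)
  obtain B where B: "\<And>x0 \<rho>. x0 \<in> Q0 \<Longrightarrow> 0 < \<rho> \<Longrightarrow> (1 / \<rho> ^ CARD('n)) *
        (LINT x:cube_in Q0 x0 \<rho>|lebesgue. \<bar>f x - avg (cube_in Q0 x0 \<rho>) (\<lambda>y. \<bar>f y\<bar>)\<bar>) \<le> B"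
    using L by (auto simp: Lbar1n_iff)
  define C where "C = B / 2 ^ CARD('n)"
  have C: "avg Q (\<lambda>x. \<bar>f x - avg Q (\<lambda>y. \<bar>f y\<bar>)\<bar>) \<le> C" if Q: "is_cube Q" "Q \<subseteq> Q0" for Q
  proof -
    obtain x \<rho> where \<rho>: "0 < \<rho>" "Q = cube x \<rho>" using Q by (auto simp: is_cube_def)
    have "x \<in> Q" using \<rho> by (simp add: mem_cube)
    moreover have "cube_in Q0 x \<rho> = Q" using Q \<rho> by (auto simp: cube_in_def)
    ultimately have "(1 / \<rho> ^ CARD('n)) * (LINT y:Q|lebesgue. \<bar>f y - avg Q (\<lambda>y. \<bar>f y\<bar>)\<bar>) \<le> B"
      using B[of x \<rho>] Q \<rho> by auto
    hence "(1 / \<rho> ^ CARD('n)) * (LINT y:Q|lebesgue. \<bar>f y - avg Q (\<lambda>y. \<bar>f y\<bar>)\<bar>) / 2 ^ CARD('n) \<le> C"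
      unfolding C_def by (rule divide_right_mono) simp
    moreover have "measure lebesgue Q = 2 ^ CARD('n) * \<rho> ^ CARD('n)"
      using \<rho> by (simp add: measure_cube power_mult_distrib)
    ultimately show ?thesis by (simp add: avg_def mult.commute)
  qed
  have neg: "2 * avg Q (neg_part f) \<le> C" if Q: "is_cube Q" "Q \<subseteq> Q0" for Q
    using avg_neg_part_le(1)[OF is_cube_lmeasurable[OF Q(1)]
        L1_subset[OF f Q(2) is_cube_lmeasurable(1)[OF Q(1)]]] C[OF Q] by linarith
  have "avg Q (\<lambda>x. \<bar>f x - avg Q f\<bar>) \<le> 2 * C" if Q: "is_cube Q" "Q \<subseteq> Q0" for Q
  proof -
    note m = is_cube_lmeasurable[OF Q(1)]
    have i: "set_integrable lebesgue Q f" by (rule L1_subset[OF f Q(2) m(1)])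
    have "avg Q (\<lambda>x. \<bar>f x - f x\<bar>) = 0" by (simp add: avg_def)
    thus ?thesis
      using avg_dev_le[OF m i i, of "avg Q f" "avg Q (\<lambda>y. \<bar>f y\<bar>)"] C[OF Q] neg[OF Q]
        avg_abs_diff_avg[OF i] abs_avg_diff_const_le[OF m i, of "avg Q (\<lambda>y. \<bar>f y\<bar>)"]
      by linarith
  qed
  hence "f \<in> BMO Q0" using f by (auto simp: BMO_iff)
  moreover have "neg_part f \<in> Linfty Q0"
    by (rule neg_part_Linfty_if_avg_cubes_le[OF Q0 f, of "C / 2"]) (use neg in force)
  ultimately show ?thesis ..
qed

lemma Lbar1n_if_BMO_and_neg_part_Linfty:
  fixes Q0 :: "(real ^ 'n) set"
  assumes Q0: "is_cube Q0" and f: "f \<in> BMO Q0" "neg_part f \<in> Linfty Q0"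
  shows "f \<in> Lbar1n Q0"
proof -
  have L1: "f \<in> L1 Q0" using f by (simp add: BMO_iff)
  obtain B where B: "\<And>Q. is_cube Q \<Longrightarrow> Q \<subseteq> Q0 \<Longrightarrow> avg Q (\<lambda>x. \<bar>f x - avg Q f\<bar>) \<le> B"
    using f by (auto simp: BMO_iff)
  obtain M where M: "0 \<le> M" "AE x\<in>Q0 in lebesgue. neg_part f x \<le> M"
    using AE_neg_part_le[OF _ f(2)] is_cube_lmeasurable(1)[OF Q0] by (auto simp: fmeasurable_def)
  have "(1 / \<rho> ^ CARD('n)) *
      (LINT x:cube_in Q0 x0 \<rho>|lebesgue. \<bar>f x - avg (cube_in Q0 x0 \<rho>) (\<lambda>y. \<bar>f y\<bar>)\<bar>)
      \<le> 2 ^ CARD('n) * (2 * B + 2 * M)" if "0 < \<rho>" for x0 \<rho>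
  proof -
    define E where "E = cube_in Q0 x0 \<rho>"
    obtain x r where r: "0 < r" "r \<le> \<rho>" and sub: "E \<subseteq> cube x r" "cube x r \<subseteq> Q0"
      unfolding E_def using cube_in_subset_cube[OF Q0 \<open>0 < \<rho>\<close>] .
    define Q where "Q = cube x r"
    have Q: "is_cube Q" "Q \<subseteq> Q0" using r sub by (auto simp: Q_def is_cube_def)
    note m = is_cube_lmeasurable[OF Q(1)]
    have E: "E \<in> lmeasurable" "E \<subseteq> Q" "E \<subseteq> Q0"
      using is_cube_lmeasurable(1)[OF Q0] sub by (auto simp: E_def cube_in_def Q_def intro: fmeasurable.Int)
    have iQ: "set_integrable lebesgue Q f" by (rule L1_subset[OF L1 Q(2) m(1)])
    have iE: "set_integrable lebesgue E f" by (rule L1_subset[OF L1 E(3,1)])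
    let ?I = "\<lambda>S. LINT x:S|lebesgue. \<bar>f x - avg Q f\<bar>"
    have "AE x\<in>E in lebesgue. neg_part f x \<le> M"
      using M(2) by eventually_elim (use E in auto)
    hence "(LINT x:E|lebesgue. \<bar>f x - avg E (\<lambda>y. \<bar>f y\<bar>)\<bar>) \<le> 2 * ?I E + 2 * M * measure lebesgue E"
      by (rule integral_dev_avg_abs_le[OF E(1) iE])
    also have "\<dots> \<le> 2 * ?I Q + 2 * M * measure lebesgue Q"
    proof -
      have "?I E \<le> ?I Q"
        using set_integrable_dev[OF m(1) iQ, of "avg Q f"] set_integrable_dev[OF E(1) iE, of "avg Q f"] E(2)
        unfolding set_lebesgue_integral_def set_integrable_def
        by (intro integral_mono) (auto simp: indicator_def)
      moreover have "measure lebesgue E \<le> measure lebesgue Q"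
        using E m by (intro measure_mono_fmeasurable) (auto simp: fmeasurable_def)
      ultimately show ?thesis using M(1) by (intro add_mono mult_left_mono) auto
    qed
    also have "\<dots> = measure lebesgue Q * (2 * avg Q (\<lambda>x. \<bar>f x - avg Q f\<bar>) + 2 * M)"
      by (simp add: measure_mult_avg[OF m(2), symmetric] algebra_simps)
    also have "\<dots> \<le> measure lebesgue Q * (2 * B + 2 * M)"
      using B[OF Q] by (intro mult_left_mono) auto
    also have "\<dots> \<le> (2 * \<rho>) ^ CARD('n) * (2 * B + 2 * M)"
    proof (rule mult_right_mono)
      show "measure lebesgue Q \<le> (2 * \<rho>) ^ CARD('n)"
        using r by (simp add: Q_def measure_cube power_mono)
      have "0 \<le> avg Q (\<lambda>x. \<bar>f x - avg Q f\<bar>)"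
        by (auto simp: avg_def set_lebesgue_integral_def
            intro!: divide_nonneg_nonneg Bochner_Integration.integral_nonneg)
      thus "0 \<le> 2 * B + 2 * M" using B[OF Q] M(1) by linarith
    qed
    finally show ?thesis using \<open>0 < \<rho>\<close>
      by (simp add: E_def divide_le_eq power_mult_distrib mult_ac)
  qed
  thus ?thesis using L1 by (auto simp: Lbar1n_iff)
qed

lemma BMO_and_neg_part_Linfty_iff_abs_dev:
  assumes Q0: "is_cube Q0" and L1: "f \<in> L1 Q0"
  shows "f \<in> BMO Q0 \<and> neg_part f \<in> Linfty Q0 \<longleftrightarrow>
           (\<exists>C. \<forall>Q. is_cube Q \<and> Q \<subseteq> Q0 \<longrightarrow> avg Q (\<lambda>x. \<bar>\<bar>f x\<bar> - avg Q f\<bar>) \<le> C)"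
    (is "?L \<longleftrightarrow> ?R")
proof
  assume ?L
  then obtain B where B: "\<And>Q. is_cube Q \<Longrightarrow> Q \<subseteq> Q0 \<Longrightarrow> avg Q (\<lambda>x. \<bar>f x - avg Q f\<bar>) \<le> B"
    by (auto simp: BMO_iff)
  obtain M where M: "AE x\<in>Q0 in lebesgue. neg_part f x \<le> M"
    using AE_neg_part_le[of Q0 f] \<open>?L\<close> is_cube_lmeasurable(1)[OF Q0] by (auto simp: fmeasurable_def)
  have "avg Q (\<lambda>x. \<bar>\<bar>f x\<bar> - avg Q f\<bar>) \<le> B + 2 * M" if Q: "is_cube Q" "Q \<subseteq> Q0" for Q
  proof -
    note m = is_cube_lmeasurable[OF Q(1)]
    have i: "set_integrable lebesgue Q f" by (rule L1_subset[OF L1 Q(2) m(1)])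
    have "AE x\<in>Q in lebesgue. neg_part f x \<le> M"
      using M by eventually_elim (use Q in auto)
    hence "avg Q (neg_part f) \<le> M"
      by (rule avg_le_const[OF m set_integrable_neg_part[OF i]])
    thus ?thesis
      using avg_dev_le[OF m set_integrable_abs[OF i] i, of "avg Q f" "avg Q f"] B[OF Q]
        avg_dist_abs_self[of Q f] by linarith
  qed
  thus ?R by blast
next
  assume ?R
  then obtain C where C: "\<And>Q. is_cube Q \<Longrightarrow> Q \<subseteq> Q0 \<Longrightarrow> avg Q (\<lambda>x. \<bar>\<bar>f x\<bar> - avg Q f\<bar>) \<le> C"
    by blast
  have neg: "2 * avg Q (neg_part f) \<le> C" if Q: "is_cube Q" "Q \<subseteq> Q0" for Q
    using avg_neg_part_le(2)[OF is_cube_lmeasurable[OF Q(1)]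
        L1_subset[OF L1 Q(2) is_cube_lmeasurable(1)[OF Q(1)]]] C[OF Q] by linarith
  have "avg Q (\<lambda>x. \<bar>f x - avg Q f\<bar>) \<le> 2 * C" if Q: "is_cube Q" "Q \<subseteq> Q0" for Q
  proof -
    note m = is_cube_lmeasurable[OF Q(1)]
    have i: "set_integrable lebesgue Q f" by (rule L1_subset[OF L1 Q(2) m(1)])
    have "avg Q (\<lambda>x. \<bar>f x - \<bar>f x\<bar>\<bar>) = 2 * avg Q (neg_part f)"
      using avg_dist_abs_self[of Q f] by (simp add: abs_minus_commute)
    thus ?thesis
      using avg_dev_le[OF m i set_integrable_abs[OF i], of "avg Q f" "avg Q f"] C[OF Q] neg[OF Q]
      by linarith
  qed
  hence "f \<in> BMO Q0" using L1 by (auto simp: BMO_iff)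
  moreover have "neg_part f \<in> Linfty Q0"
    by (rule neg_part_Linfty_if_avg_cubes_le[OF Q0 L1, of "C / 2"]) (use neg in force)
  ultimately show ?L ..
qed

theorem theorem3p5:
  fixes Q0 :: "(real ^ 'n) set" and f :: "real ^ 'n \<Rightarrow> real"
  assumes "is_cube Q0" and "f \<in> L1 Q0"
  shows "(f \<in> Lbar1n Q0 \<longleftrightarrow> f \<in> BMO Q0 \<and> neg_part f \<in> Linfty Q0) \<and>
         (f \<in> BMO Q0 \<and> neg_part f \<in> Linfty Q0 \<longleftrightarrow>
           (\<exists>C. \<forall>Q. is_cube Q \<and> Q \<subseteq> Q0 \<longrightarrow> avg Q (\<lambda>x. \<bar>\<bar>f x\<bar> - avg Q f\<bar>) \<le> C))"
  using BMO_and_neg_part_Linfty_if_Lbar1n Lbar1n_if_BMO_and_neg_part_Linfty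
    BMO_and_neg_part_Linfty_iff_abs_dev assms by blast

end
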